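(* Let $T:\ell^2(\mathbb Z)\to\ell^2(\mathbb Z)$ be a bilateral (backward) weighted shift with weight sequence $(w_n)_{n\in\mathbb Z}$. The following are equivalent: (i) $T$ is topologically multiply recurrent. (ii) For every $m\in\mathbb N$ the operator $T\oplus T^2\oplus\cdots\oplus T^m$ is hypercyclic on $\ell^2(\mathbb Z)^m$. (iii) For every $m\in\mathbb N$ the operators $T,T^2,\ldots,T^m$ are densely $d$-hypercyclic. (iv) For every $m,q\in\mathbb N$ and every $\epsilon>0$ there exists a positive integer $n=n(m,q,\epsilon)$ such that for every integer $j$ with $|j|\le q$ and every $l=1,\ldots,m$ we have $$\prod_{i=1}^{ln}w_{j+i}>\frac1\epsilon\quad\text{and}\quad\prod_{i=0}^{ln-1}w_{j-i}<\epsilon.$$ If in addition $T$ is invertible, then any of the conditions (i)–(iv) is equivalent to: (v) For every $m\in\mathbb N$ there exists a strictly increasing sequence of positive integers $(n_k)$ such that $$\lim_{k\to+\infty}\prod_{i=1}^{ln_k}w_i=\lim_{k\to+\infty}\prod_{i=0}^{ln_k}\frac1{w_{-i}}=+\infty$$ for every $l=1,\ldots,m$.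
   Context: $\mathbb N$ denotes the set of positive integers. $\ell^2(\mathbb Z)$ is the complex Hilbert space of square summable sequences indexed by $\mathbb Z$, with canonical basis $(e_n)_{n\in\mathbb Z}$. Given a bounded sequence $(w_n)_{n\in\mathbb Z}$ of positive numbers, the *bilateral (backward) weighted shift* with weight sequence $(w_n)_{n\in\mathbb Z}$ is the bounded linear operator $T$ on $\ell^2(\mathbb Z)$ with $Te_n=w_ne_{n-1}$ for every $n\in\mathbb Z$. Let $X$ be a Banach space and $S$ a bounded linear operator on $X$. - $S$ is *hypercyclic* if there is $x\in X$ such that $\{S^nx:n=0,1,2,\ldots\}$ is dense in $X$. - $S$ is *topologically multiply recurrent* if for every non-empty open set $U\subset X$ and every positive integer $m$ there is a positive integer $k$ such that $U\cap S^{-k}U\cap\cdots\cap S^{-mk}U\neq\emptyset$, where $S^{-j}U=(S^j)^{-1}(U)$. - Bounded linear operators $T_1,\ldots,T_N$ on $X$ are *densely $d$-hypercyclic* if the set of vectors $x\in X$ for which $\{(T_1^nx,\ldots,T_N^nx):n=0,1,2,\ldots\}$ is dense in $X^N$ is itself dense in $X$. (For $N=1$ this means that $T_1$ has a dense set of hypercyclic vectors.) *)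

theory Defs
  imports "HOL-Analysis.Analysis"
begin

section \<open>The complex Hilbert space of square summable sequences indexed by the integers\<close>

typedef ell2_int = "{f :: int \<Rightarrow> complex. (\<lambda>n. (norm (f n))\<^sup>2) summable_on UNIV}"
  morphisms coord Abs_ell2_int
  by (rule exI[of _ "\<lambda>_. 0"]) simp

lemma coord_summable: "(\<lambda>n. (norm (coord x n))\<^sup>2) summable_on UNIV"
  using coord[of x] by simp

lemma ell2_int_eqI: "(\<And>n. coord x n = coord y n) \<Longrightarrow> x = y"
  by (simp add: coord_inject[symmetric] fun_eq_iff)

lemma square_summable_add:
  fixes f g :: "int \<Rightarrow> complex"
  assumes "(\<lambda>n. (norm (f n))\<^sup>2) summable_on UNIV" "(\<lambda>n. (norm (g n))\<^sup>2) summable_on UNIV"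
  shows "(\<lambda>n. (norm (f n + g n))\<^sup>2) summable_on UNIV"
proof (rule summable_on_comparison_test)
  show "(\<lambda>n. 2 * (norm (f n))\<^sup>2 + 2 * (norm (g n))\<^sup>2) summable_on UNIV"
    using assms by (intro summable_on_add summable_on_cmult_right)
  fix n
  have "(norm (f n + g n))\<^sup>2 \<le> (norm (f n) + norm (g n))\<^sup>2"
    by (intro power_mono norm_triangle_ineq) simp
  also have "\<dots> \<le> 2 * (norm (f n))\<^sup>2 + 2 * (norm (g n))\<^sup>2"
    using sum_squares_bound[of "norm (f n)" "norm (g n)"] by (simp add: power2_sum)
  finally show "(norm (f n + g n))\<^sup>2 \<le> 2 * (norm (f n))\<^sup>2 + 2 * (norm (g n))\<^sup>2" .
qed simp

lemma square_summable_bounded_mult: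
  fixes f g :: "int \<Rightarrow> complex"
  assumes "(\<lambda>n. (norm (f n))\<^sup>2) summable_on UNIV" "\<And>n. norm (g n) \<le> K"
  shows "(\<lambda>n. (norm (g n * f n))\<^sup>2) summable_on UNIV"
proof (rule summable_on_comparison_test)
  show "(\<lambda>n. K\<^sup>2 * (norm (f n))\<^sup>2) summable_on UNIV"
    using assms by (intro summable_on_cmult_right)
  show "(norm (g n * f n))\<^sup>2 \<le> K\<^sup>2 * (norm (f n))\<^sup>2" for n
    unfolding norm_mult power_mult_distrib
    by (intro mult_right_mono power_mono assms) auto
qed simp

lemma coord_inner_summable: "(\<lambda>n. coord x n \<bullet> coord y n) summable_on UNIV"
proof (rule abs_summable_summable, rule summable_on_comparison_test)
  show "(\<lambda>n. (norm (coord x n))\<^sup>2 + (norm (coord y n))\<^sup>2) summable_on UNIV"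
    by (intro summable_on_add coord_summable)
  fix n
  have "norm (coord x n \<bullet> coord y n) \<le> norm (coord x n) * norm (coord y n)"
    using Cauchy_Schwarz_ineq2 by simp
  also have "\<dots> \<le> (norm (coord x n))\<^sup>2 + (norm (coord y n))\<^sup>2"
    using sum_squares_bound[of "norm (coord x n)" "norm (coord y n)"]
      mult_nonneg_nonneg[OF norm_ge_zero norm_ge_zero, of "coord x n" "coord y n"] by linarith
  finally show "norm (coord x n \<bullet> coord y n) \<le> (norm (coord x n))\<^sup>2 + (norm (coord y n))\<^sup>2" .
qed simp

instantiation ell2_int :: real_vector
begin

definition "0 = Abs_ell2_int (\<lambda>_. 0)"
definition "x + y = Abs_ell2_int (\<lambda>n. coord x n + coord y n)"
definition "- x = Abs_ell2_int (\<lambda>n. - coord x n)"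
definition "x - y = Abs_ell2_int (\<lambda>n. coord x n - coord y n)"
definition "r *\<^sub>R x = Abs_ell2_int (\<lambda>n. r *\<^sub>R coord x n)"

lemma coord_zero [simp]: "coord 0 n = 0"
  by (simp add: zero_ell2_int_def Abs_ell2_int_inverse)

lemma coord_add [simp]: "coord (x + y) n = coord x n + coord y n"
  using square_summable_add[OF coord_summable coord_summable, of x y]
  by (simp add: plus_ell2_int_def Abs_ell2_int_inverse)

lemma coord_uminus [simp]: "coord (- x) n = - coord x n"
  using coord_summable[of x]
  by (simp add: uminus_ell2_int_def Abs_ell2_int_inverse)

lemma coord_diff [simp]: "coord (x - y) n = coord x n - coord y n"
  using square_summable_add[OF coord_summable coord_summable, of x "- y"]
  by (simp add: minus_ell2_int_def Abs_ell2_int_inverse)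

lemma coord_scaleR [simp]: "coord (r *\<^sub>R x) n = r *\<^sub>R coord x n"
  using square_summable_bounded_mult[OF coord_summable, of "\<lambda>_. of_real r" "\<bar>r\<bar>" x]
  by (simp add: scaleR_ell2_int_def Abs_ell2_int_inverse scaleR_conv_of_real)

instance
  by standard (auto intro!: ell2_int_eqI simp: algebra_simps)

end

definition scaleC_ell2 :: "complex \<Rightarrow> ell2_int \<Rightarrow> ell2_int"  (infixr \<open>*\<^sub>C\<close> 75)
  where "c *\<^sub>C x = Abs_ell2_int (\<lambda>n. c * coord x n)"

lemma coord_scaleC [simp]: "coord (c *\<^sub>C x) n = c * coord x n"
  using square_summable_bounded_mult[OF coord_summable, of "\<lambda>_. c" "norm c" x]
  by (simp add: scaleC_ell2_def Abs_ell2_int_inverse)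

text \<open>The class structure is the underlying real Hilbert space: the inner product below is the
  real part of the complex one, so the norm is the usual norm of square summable sequences.\<close>

instantiation ell2_int :: real_inner
begin

definition inner_ell2_int :: "ell2_int \<Rightarrow> ell2_int \<Rightarrow> real"
  where "inner_ell2_int x y = (\<Sum>\<^sub>\<infinity>n. coord x n \<bullet> coord y n)"
definition norm_ell2_int :: "ell2_int \<Rightarrow> real"
  where "norm_ell2_int x = sqrt (\<Sum>\<^sub>\<infinity>n. (norm (coord x n))\<^sup>2)"
definition sgn_ell2_int :: "ell2_int \<Rightarrow> ell2_int"
  where "sgn_ell2_int x = x /\<^sub>R norm x"
definition dist_ell2_int :: "ell2_int \<Rightarrow> ell2_int \<Rightarrow> real"
  where "dist_ell2_int x y = norm (x - y)"
definition uniformity_ell2_int :: "(ell2_int \<times> ell2_int) filter"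
  where "uniformity_ell2_int = (INF e\<in>{0 <..}. principal {(x, y). dist x y < e})"
definition open_ell2_int :: "ell2_int set \<Rightarrow> bool"
  where "open_ell2_int U \<longleftrightarrow> (\<forall>x\<in>U. \<forall>\<^sub>F (x', y) in uniformity. x' = x \<longrightarrow> y \<in> U)"

instance
proof
  fix x y z :: ell2_int and r :: real
  show "x \<bullet> y = y \<bullet> x"
    by (simp add: inner_ell2_int_def inner_commute)
  show "(x + y) \<bullet> z = x \<bullet> z + y \<bullet> z"
    by (simp add: inner_ell2_int_def inner_add_left infsum_add coord_inner_summable)
  show "(r *\<^sub>R x) \<bullet> y = r * (x \<bullet> y)"
    by (simp only: inner_ell2_int_def coord_scaleR inner_scaleR_left)
      (rule infsum_cmult_right, rule coord_inner_summable)
  show "0 \<le> x \<bullet> x"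
    by (simp add: inner_ell2_int_def infsum_nonneg)
  show "x \<bullet> x = 0 \<longleftrightarrow> x = 0"
  proof
    assume "x \<bullet> x = 0"
    then have "coord x n \<bullet> coord x n = 0" for n
      by (intro nonneg_infsum_le_0D[where f = "\<lambda>n. coord x n \<bullet> coord x n" and A = UNIV])
        (auto simp: inner_ell2_int_def intro: coord_inner_summable)
    then show "x = 0"
      by (intro ell2_int_eqI) simp
  qed (simp add: inner_ell2_int_def)
  show "norm x = sqrt (x \<bullet> x)"
    by (simp add: norm_ell2_int_def inner_ell2_int_def power2_norm_eq_inner)
qed (simp_all add: sgn_ell2_int_def dist_ell2_int_def uniformity_ell2_int_def open_ell2_int_def)

end

lemma norm_ell2_squared: "(norm x)\<^sup>2 = (\<Sum>\<^sub>\<infinity>n. (norm (coord x n))\<^sup>2)" for x :: ell2_int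
  by (simp add: norm_ell2_int_def infsum_nonneg)

lemma sum_le_norm_ell2:
  "finite F \<Longrightarrow> (\<Sum>n\<in>F. (norm (coord x n))\<^sup>2) \<le> (norm x)\<^sup>2" for x :: ell2_int
  unfolding norm_ell2_squared by (rule finite_sum_le_infsum[OF coord_summable]) auto

lemma norm_coord_le: "norm (coord x n) \<le> norm x"
  by (rule power2_le_imp_le) (use sum_le_norm_ell2[of "{n}" x] in simp_all)

lemma norm_ell2_leI:
  fixes x :: ell2_int
  assumes "\<And>F. finite F \<Longrightarrow> (\<Sum>n\<in>F. (norm (coord x n))\<^sup>2) \<le> B\<^sup>2" "0 \<le> B"
  shows "norm x \<le> B"
proof (rule power2_le_imp_le)
  show "(norm x)\<^sup>2 \<le> B\<^sup>2"
    unfolding norm_ell2_squared by (rule infsum_le_finite_sums[OF coord_summable]) (use assms in auto)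
qed fact

lemma norm_scaleC: "norm (c *\<^sub>C x) = norm c * norm x"
  by (simp add: norm_ell2_int_def norm_mult power_mult_distrib infsum_cmult_right'
      real_sqrt_mult)

lemma vector_space_scaleC: "vector_space scaleC_ell2"
  by standard (auto intro!: ell2_int_eqI simp: algebra_simps)

instance ell2_int :: complete_space
proof
  fix X :: "nat \<Rightarrow> ell2_int"
  assume X: "Cauchy X"
  have "Cauchy (\<lambda>k. coord (X k) n)" for n
  proof (rule metric_CauchyI)
    fix e :: real assume "e > 0"
    then obtain M where M: "\<And>k l. k \<ge> M \<Longrightarrow> l \<ge> M \<Longrightarrow> dist (X k) (X l) < e"
      using metric_CauchyD[OF X] by blast
    have "dist (coord (X k) n) (coord (X l) n) \<le> dist (X k) (X l)" for k l
      using norm_coord_le[of "X k - X l" n] by (simp add: dist_norm)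
    with M show "\<exists>M. \<forall>k\<ge>M. \<forall>l\<ge>M. dist (coord (X k) n) (coord (X l) n) < e"
      by (meson le_less_trans)
  qed
  then have "\<exists>a. (\<lambda>k. coord (X k) n) \<longlonglongrightarrow> a" for n
    by (simp add: Cauchy_convergent_iff convergent_def)
  then obtain f where f: "\<And>n. (\<lambda>k. coord (X k) n) \<longlonglongrightarrow> f n"
    by metis
  have tail: "\<exists>M. \<forall>k\<ge>M. \<forall>F. finite F \<longrightarrow> (\<Sum>n\<in>F. (norm (coord (X k) n - f n))\<^sup>2) \<le> e\<^sup>2"
    if e: "e > 0" for e :: real
  proof -
    obtain M where M: "\<And>k l. k \<ge> M \<Longrightarrow> l \<ge> M \<Longrightarrow> dist (X k) (X l) < e"
      using metric_CauchyD[OF X e] by blast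
    have "(\<Sum>n\<in>F. (norm (coord (X k) n - f n))\<^sup>2) \<le> e\<^sup>2" if "k \<ge> M" "finite F" for k F
    proof (rule Lim_bounded)
      show "(\<lambda>l. \<Sum>n\<in>F. (norm (coord (X k) n - coord (X l) n))\<^sup>2)
          \<longlonglongrightarrow> (\<Sum>n\<in>F. (norm (coord (X k) n - f n))\<^sup>2)"
        by (intro tendsto_intros f)
      show "\<forall>l\<ge>M. (\<Sum>n\<in>F. (norm (coord (X k) n - coord (X l) n))\<^sup>2) \<le> e\<^sup>2"
      proof (intro allI impI)
        fix l assume "l \<ge> M"
        have "(\<Sum>n\<in>F. (norm (coord (X k) n - coord (X l) n))\<^sup>2) \<le> (norm (X k - X l))\<^sup>2"
          using sum_le_norm_ell2[OF \<open>finite F\<close>, of "X k - X l"] by simp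
        also have "\<dots> \<le> e\<^sup>2"
          using M[OF \<open>k \<ge> M\<close> \<open>l \<ge> M\<close>] by (intro power_mono) (auto simp: dist_norm)
        finally show "(\<Sum>n\<in>F. (norm (coord (X k) n - coord (X l) n))\<^sup>2) \<le> e\<^sup>2" .
      qed
    qed
    then show ?thesis by blast
  qed
  obtain M where M: "\<And>F. finite F \<Longrightarrow> (\<Sum>n\<in>F. (norm (coord (X M) n - f n))\<^sup>2) \<le> 1"
    using tail[of 1] by auto
  have "(\<lambda>n. (norm (coord (X M) n - f n))\<^sup>2) summable_on UNIV"
    by (rule nonneg_bdd_above_summable_on) (auto intro!: bdd_aboveI[of _ 1] M)
  then have "(\<lambda>n. (norm (f n - coord (X M) n))\<^sup>2) summable_on UNIV"
    by (simp add: norm_minus_commute)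
  from square_summable_add[OF this coord_summable[of "X M"]]
  have cf: "coord (Abs_ell2_int f) = f"
    by (intro Abs_ell2_int_inverse) simp
  have "X \<longlonglongrightarrow> Abs_ell2_int f"
  proof (rule metric_LIMSEQ_I)
    fix r :: real assume "r > 0"
    then obtain M where
      "\<And>k F. k \<ge> M \<Longrightarrow> finite F \<Longrightarrow> (\<Sum>n\<in>F. (norm (coord (X k) n - f n))\<^sup>2) \<le> (r / 2)\<^sup>2"
      using tail[of "r / 2"] by auto
    then have "norm (X k - Abs_ell2_int f) \<le> r / 2" if "k \<ge> M" for k
      using that \<open>r > 0\<close> by (intro norm_ell2_leI) (auto simp: cf)
    then show "\<exists>M. \<forall>k\<ge>M. dist (X k) (Abs_ell2_int f) < r"
      using \<open>r > 0\<close> by (intro exI[of _ M]) (force simp: dist_norm)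
  qed
  then show "convergent X"
    by (auto simp: convergent_def)
qed

instance ell2_int :: banach ..

definition basis_vec :: "int \<Rightarrow> ell2_int"
  where "basis_vec n = Abs_ell2_int (\<lambda>k. if k = n then 1 else 0)"

lemma coord_basis_vec: "coord (basis_vec n) k = (if k = n then 1 else 0)"
proof -
  have "(\<lambda>k. (norm (if k = n then 1 else 0 :: complex))\<^sup>2) summable_on UNIV"
    by (rule finite_nonzero_values_imp_summable_on)
      (rule finite_subset[of _ "{n}"], auto split: if_splits)
  then show ?thesis
    unfolding basis_vec_def by (subst Abs_ell2_int_inverse) auto
qed

section \<open>Operators and weighted shifts\<close>

definition bounded_clinear :: "(ell2_int \<Rightarrow> ell2_int) \<Rightarrow> bool"
  where "bounded_clinear T \<longleftrightarrow> bounded_linear T \<and> (\<forall>c x. T (c *\<^sub>C x) = c *\<^sub>C T x)"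

definition invertible_operator :: "(ell2_int \<Rightarrow> ell2_int) \<Rightarrow> bool"
  where "invertible_operator T \<longleftrightarrow>
    (\<exists>S. bounded_clinear S \<and> S \<circ> T = id \<and> T \<circ> S = id)"

definition bilateral_weighted_shift :: "(int \<Rightarrow> real) \<Rightarrow> (ell2_int \<Rightarrow> ell2_int) \<Rightarrow> bool"
  where "bilateral_weighted_shift w T \<longleftrightarrow>
    bounded (range w) \<and> (\<forall>n. 0 < w n) \<and> bounded_clinear T \<and>
    (\<forall>n. T (basis_vec n) = of_real (w n) *\<^sub>C basis_vec (n - 1))"

lemma bilateral_weighted_shift_exists:
  assumes w: "bounded (range w)" "\<And>n. 0 < w n"
  shows "\<exists>T. bilateral_weighted_shift w T"
proof -
  obtain K where K: "\<And>n. \<bar>w n\<bar> \<le> K"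
    using w(1) by (auto simp: bounded_iff)
  have K0: "0 \<le> K"
    using K[of 0] by linarith
  define T where "T x = Abs_ell2_int (\<lambda>n. of_real (w (n + 1)) * coord x (n + 1))" for x
  have bij: "bij_betw (\<lambda>n::int. n + 1) UNIV UNIV"
    by (rule bij_betwI[of _ _ _ "\<lambda>n. n - 1"]) auto
  have cT: "coord (T x) n = of_real (w (n + 1)) * coord x (n + 1)" for x n
  proof -
    have "(\<lambda>n. (norm (of_real (w n) * coord x n))\<^sup>2) summable_on UNIV"
      by (rule square_summable_bounded_mult[OF coord_summable]) (use K in simp)
    then have "(\<lambda>n. (norm (of_real (w (n + 1)) * coord x (n + 1)))\<^sup>2) summable_on UNIV"
      by (subst summable_on_reindex_bij_betw[OF bij, of "\<lambda>n. (norm (of_real (w n) * coord x n))\<^sup>2"])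
    then show ?thesis
      unfolding T_def by (subst Abs_ell2_int_inverse) simp_all
  qed
  have "norm (T x) \<le> norm x * K" for x
  proof (rule norm_ell2_leI)
    fix F :: "int set" assume F: "finite F"
    have "(\<Sum>n\<in>F. (norm (coord (T x) n))\<^sup>2) \<le> (\<Sum>n\<in>F. K\<^sup>2 * (norm (coord x (n + 1)))\<^sup>2)"
      unfolding cT norm_mult power_mult_distrib norm_of_real
      by (intro sum_mono mult_right_mono power_mono K) auto
    also have "\<dots> = K\<^sup>2 * (\<Sum>n\<in>(\<lambda>n. n + 1) ` F. (norm (coord x n))\<^sup>2)"
      by (subst sum.reindex) (auto simp: sum_distrib_left)
    also have "\<dots> \<le> K\<^sup>2 * (norm x)\<^sup>2"
      by (intro mult_left_mono sum_le_norm_ell2) (use F in auto)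
    finally show "(\<Sum>n\<in>F. (norm (coord (T x) n))\<^sup>2) \<le> (norm x * K)\<^sup>2"
      by (simp add: power_mult_distrib mult.commute)
  qed (use K0 in simp)
  then have "bounded_linear T"
    by (intro bounded_linear_intro) (auto intro!: ell2_int_eqI simp: cT algebra_simps)
  moreover have "T (basis_vec n) = of_real (w n) *\<^sub>C basis_vec (n - 1)" for n
    by (rule ell2_int_eqI) (auto simp: cT coord_basis_vec)
  moreover have "T (c *\<^sub>C x) = c *\<^sub>C T x" for c x
    by (rule ell2_int_eqI) (simp add: cT)
  ultimately show ?thesis
    using w by (auto simp: bilateral_weighted_shift_def bounded_clinear_def)
qed

section \<open>Hypercyclicity and recurrence\<close>

text \<open>The power $X^N$ is the library product topology with index set \<open>{1..N}\<close>; its points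
  are the functions that are undefined outside \<open>{1..N}\<close>. Only the topology of the
  underlying space enters the following notions.\<close>

abbreviation power_space :: "nat \<Rightarrow> (nat \<Rightarrow> 'a::topological_space) topology"
  where "power_space N \<equiv> product_topology (\<lambda>_. euclidean) {1..N}"

definition direct_sum_op :: "nat \<Rightarrow> (nat \<Rightarrow> 'a \<Rightarrow> 'a) \<Rightarrow> (nat \<Rightarrow> 'a) \<Rightarrow> (nat \<Rightarrow> 'a)"
  where "direct_sum_op N Ts x = (\<lambda>l\<in>{1..N}. Ts l (x l))"

definition hypercyclic_on :: "'a topology \<Rightarrow> ('a \<Rightarrow> 'a) \<Rightarrow> bool"
  where "hypercyclic_on X S \<longleftrightarrow>
    (\<exists>x\<in>topspace X. X closure_of {(S ^^ n) x | n. True} = topspace X)"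

definition topologically_multiply_recurrent :: "('a::topological_space \<Rightarrow> 'a) \<Rightarrow> bool"
  where "topologically_multiply_recurrent S \<longleftrightarrow>
    (\<forall>U. open U \<and> U \<noteq> {} \<longrightarrow>
      (\<forall>m\<ge>1. \<exists>k\<ge>1. U \<inter> (\<Inter>j\<in>{1..m}. (S ^^ (j * k)) -` U) \<noteq> {}))"

definition densely_d_hypercyclic :: "nat \<Rightarrow> (nat \<Rightarrow> 'a::topological_space \<Rightarrow> 'a) \<Rightarrow> bool"
  where "densely_d_hypercyclic N Ts \<longleftrightarrow>
    closure {x. power_space N closure_of {(\<lambda>l\<in>{1..N}. (Ts l ^^ n) x) | n. True}
                = topspace (power_space N)} = UNIV"

end

theory Submission
  imports Defs
begin

text \<open>Write the weights as \<open>w n = W n / W (n - 1)\<close>, so that all products of weights telescope.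
  Each \<open>e\<^sub>j\<close> has a two-sided orbit under \<open>T\<close>, whose element at time \<open>d\<close> has norm
  \<open>W j / W (j - d)\<close>, and (iv) says that at some \<open>n\<close> these norms are small at all times
  \<open>\<plusminus>ln\<close>, \<open>1 \<le> l \<le> m\<close>, for the finitely many \<open>\<bar>j\<bar> \<le> q\<close>. If \<open>y\<^sub>0, \<dots>, y\<^sub>m\<close> are finitely supported,
  moving each \<open>y\<^sub>l\<close> to time \<open>-ln\<close> and adding up gives a vector whose image under \<open>T\<^bsup>kn\<^esup>\<close> is
  \<open>y\<^sub>k\<close> plus terms at the times \<open>(k - l)n\<close>, hence close to \<open>y\<^sub>k\<close>, for every \<open>k \<le> m\<close>.
  This transitivity yields (i) at once and (iii) by Baire's theorem; (iii) gives (ii) through the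
  diagonal vector. Conversely (i) and (ii) both produce vectors that are close to
  \<open>\<Sum>\<^bsub>\<bar>j\<bar>\<le>q\<^esub> e\<^sub>j\<close> at two times more than \<open>2q\<close> apart, and comparing coordinates
  bounds the weight products. When \<open>T\<close> is invertible the weights are bounded away from \<open>0\<close> as well,
  so the base point \<open>j\<close> in (iv) can be moved to \<open>0\<close> at the cost of a constant factor, which is
  (v).\<close>

section \<open>Truncations and separability\<close>

lemma coord_sum: "coord (\<Sum>i\<in>I. x i) n = (\<Sum>i\<in>I. coord (x i) n)"
  by (induction I rule: infinite_finite_induct) auto

lemma bounded_linear_coord: "bounded_linear (\<lambda>x. coord x n)"
  by (rule bounded_linear_intro[where K = 1]) (auto intro: norm_coord_le)

definition truncate_ell2 :: "int set \<Rightarrow> ell2_int \<Rightarrow> ell2_int"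
  where "truncate_ell2 F x = (\<Sum>j\<in>F. coord x j *\<^sub>C basis_vec j)"

lemma coord_truncate_ell2:
  "finite F \<Longrightarrow> coord (truncate_ell2 F x) n = (if n \<in> F then coord x n else 0)"
  by (simp add: truncate_ell2_def coord_sum coord_basis_vec if_distrib cong: if_cong)

text \<open>The squared error is a tail of the convergent sum of squared coordinates. The limit runs
  along finite index sets, so that finitely many vectors can later be truncated to one common
  set.\<close>

lemma truncate_ell2_tendsto: "((\<lambda>F. truncate_ell2 F x) \<longlongrightarrow> x) (finite_subsets_at_top UNIV)"
proof (rule tendstoI)
  fix e :: real assume e: "e > 0"
  define f where "f n = (norm (coord x n))\<^sup>2" for n
  have "(f has_sum (norm x)\<^sup>2) UNIV"
    unfolding norm_ell2_squared f_def by (intro has_sum_infsum coord_summable)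
  then have "\<forall>\<^sub>F F in finite_subsets_at_top UNIV. dist (sum f F) ((norm x)\<^sup>2) < (e / 2)\<^sup>2"
    unfolding has_sum_def by (rule tendstoD) (use e in simp)
  moreover have "\<forall>\<^sub>F F in finite_subsets_at_top (UNIV :: int set). finite F"
    by (simp add: eventually_finite_subsets_at_top_weakI)
  ultimately show "\<forall>\<^sub>F F in finite_subsets_at_top UNIV. dist (truncate_ell2 F x) x < e"
  proof eventually_elim
    case (elim F)
    have "norm (truncate_ell2 F x - x) \<le> e / 2"
    proof (rule norm_ell2_leI)
      fix G :: "int set" assume G: "finite G"
      have "(\<Sum>n\<in>G. (norm (coord (truncate_ell2 F x - x) n))\<^sup>2) = (\<Sum>n\<in>G. if n \<in> F then 0 else f n)"
        by (intro sum.cong) (auto simp: coord_truncate_ell2 elim f_def)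
      also have "\<dots> = sum f (G - F)"
        using G by (simp add: sum.If_cases Diff_eq)
      \<comment> \<open>\<open>G\<close> need not contain \<open>F\<close>. Enlarging it to
        \<open>G \<union> F\<close> turns the sum over \<open>G - F\<close> into a difference, whose
        first term is at most the whole sum.\<close>
      also have "\<dots> = sum f (G \<union> F) - sum f F"
        using sum_diff[of "G \<union> F" F f] G elim by (simp add: Un_Diff)
      also have "\<dots> \<le> (norm x)\<^sup>2 - sum f F"
        using sum_le_norm_ell2[of "G \<union> F" x] G elim by (simp add: f_def)
      also have "\<dots> \<le> (e / 2)\<^sup>2"
        using elim by (simp add: dist_real_def)
      finally show "(\<Sum>n\<in>G. (norm (coord (truncate_ell2 F x - x) n))\<^sup>2) \<le> (e / 2)\<^sup>2" .
    qed (use e in simp)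
    then show ?case
      using e by (simp add: dist_norm)
  qed
qed

lemma norm_basis_vec [simp]: "norm (basis_vec n) = 1"
proof -
  have "(norm (basis_vec n))\<^sup>2 = (\<Sum>\<^sub>\<infinity>k\<in>{n}. 1)"
    unfolding norm_ell2_squared by (rule infsum_cong_neutral) (auto simp: coord_basis_vec)
  then show ?thesis
    by (simp add: power2_eq_1_iff)
       (metis norm_ge_zero neg_0_le_iff_le not_one_le_zero)
qed

text \<open>The dense set consists of the finite combinations of basis vectors with coefficients in
  a countable dense set of complex numbers, coded by lists. Its closure is stable under adding any
  \<open>c *\<^sub>C basis_vec n\<close>, so it contains all truncations and hence their
  limits.\<close>

lemma ell2_int_separable: "\<exists>D :: ell2_int set. countable D \<and> closure D = UNIV"
proof -
  obtain C :: "complex set" where C: "countable C" "\<And>X. open X \<Longrightarrow> X \<noteq> {} \<Longrightarrow> \<exists>c\<in>C. c \<in> X"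
    using countable_dense_setE by blast
  define v :: "(complex \<times> int) list \<Rightarrow> ell2_int"
    where "v cs = (\<Sum>(c, n)\<leftarrow>cs. c *\<^sub>C basis_vec n)" for cs
  define D where "D = v ` lists (C \<times> UNIV)"
  have "countable D"
    unfolding D_def using C(1) by (intro countable_image countable_lists countable_SIGMA) auto
  have step: "c *\<^sub>C basis_vec n + x \<in> closure D" if x: "x \<in> closure D" for x c n
    unfolding closure_approachable
  proof (intro allI impI)
    fix e :: real assume e: "e > 0"
    then obtain y where y: "y \<in> D" "dist y x < e / 2"
      using x[unfolded closure_approachable, rule_format, of "e / 2"] by auto
    then obtain cs where cs: "cs \<in> lists (C \<times> UNIV)" "y = v cs"
      unfolding D_def by blast
    obtain d where d: "d \<in> C" "dist c d < e / 2"
      using C(2)[of "ball c (e / 2)"] e by auto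
    have "v ((d, n) # cs) \<in> D"
      unfolding D_def using cs d by (intro imageI) simp
    moreover have "dist (v ((d, n) # cs)) (c *\<^sub>C basis_vec n + x) < e"
    proof -
      have "v ((d, n) # cs) - (c *\<^sub>C basis_vec n + x) = (d - c) *\<^sub>C basis_vec n + (y - x)"
        by (rule ell2_int_eqI) (simp add: cs(2) v_def algebra_simps)
      then have "dist (v ((d, n) # cs)) (c *\<^sub>C basis_vec n + x)
          \<le> norm ((d - c) *\<^sub>C basis_vec n) + norm (y - x)"
        by (simp only: dist_norm norm_triangle_ineq)
      also have "\<dots> < e / 2 + e / 2"
        using d y by (intro add_strict_mono) (simp_all add: norm_scaleC dist_norm norm_minus_commute)
      finally show ?thesis by simp
    qed
    ultimately show "\<exists>y\<in>D. dist y (c *\<^sub>C basis_vec n + x) < e"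
      by blast
  qed
  have "truncate_ell2 F x \<in> closure D" if "finite F" for F x
    using that unfolding truncate_ell2_def
  proof (induction F rule: finite_induct)
    case empty
    have "v [] \<in> D"
      unfolding D_def by (intro imageI) simp
    then show ?case
      using closure_subset by (auto simp: v_def)
  qed (simp add: step)
  then have "x \<in> closure (closure D)" for x
    by (intro Lim_in_closed_set[OF closed_closure _ _ truncate_ell2_tendsto[of x]])
       (auto intro: eventually_finite_subsets_at_top_weakI closure_subset[THEN subsetD])
  with \<open>countable D\<close> show ?thesis
    by auto
qed

section \<open>Dense orbits in powers\<close>

text \<open>Boxes form a base of a finite product. The hypothesis on \<open>A\<close> turns a
  condition on coordinates into membership in a box, whose elements are \<open>undefined\<close>
  outside \<open>{1..m}\<close>.\<close>

lemma power_space_dense_iff: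
  fixes A :: "(nat \<Rightarrow> 'a::topological_space) set"
  assumes A: "A \<subseteq> PiE {1..m} (\<lambda>_. UNIV)"
  shows "power_space m closure_of A = topspace (power_space m) \<longleftrightarrow>
    (\<forall>V. (\<forall>l\<in>{1..m}. open (V l) \<and> V l \<noteq> {}) \<longrightarrow> (\<exists>a\<in>A. \<forall>l\<in>{1..m}. a l \<in> V l))"
    (is "?L \<longleftrightarrow> ?R")
proof
  assume L: ?L
  show ?R
  proof (intro allI impI)
    fix V :: "nat \<Rightarrow> 'a set" assume V: "\<forall>l\<in>{1..m}. open (V l) \<and> V l \<noteq> {}"
    then have "openin (power_space m) (PiE {1..m} V)"
      by (subst openin_PiE) auto
    moreover have "PiE {1..m} V \<noteq> {}"
      using V by (simp add: PiE_eq_empty_iff)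
    ultimately have "A \<inter> PiE {1..m} V \<noteq> {}"
      using L unfolding dense_intersects_open by blast
    then show "\<exists>a\<in>A. \<forall>l\<in>{1..m}. a l \<in> V l"
      by auto
  qed
next
  assume R: ?R
  show ?L
    unfolding dense_intersects_open
  proof (intro allI impI)
    fix S :: "(nat \<Rightarrow> 'a) set" assume S: "openin (power_space m) S \<and> S \<noteq> {}"
    then obtain z where z: "z \<in> S" by blast
    with S obtain V where V: "\<And>l. l \<in> {1..m} \<Longrightarrow> open (V l)" "z \<in> PiE {1..m} V" "PiE {1..m} V \<subseteq> S"
      unfolding openin_product_topology_alt by (metis open_openin)
    have "\<forall>l\<in>{1..m}. open (V l) \<and> V l \<noteq> {}"
      using V by (auto simp: PiE_iff)
    then obtain a where "a \<in> A" "\<forall>l\<in>{1..m}. a l \<in> V l"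
      using R by blast
    then have "a \<in> A" "a \<in> PiE {1..m} V"
      using A by (auto simp: PiE_iff)
    then have "a \<in> A \<inter> S"
      using V by blast
    then show "A \<inter> S \<noteq> {}" by blast
  qed
qed

text \<open>The countable family consists of the balls of radius \<open>1 / Suc r\<close> about
  points of \<open>D\<close>: if the radius is below \<open>e / 2\<close> and the centre is within
  \<open>e / 2\<close> of \<open>x\<close>, then the ball lies in \<open>ball x e\<close>.\<close>

lemma separable_open_base:
  fixes D :: "'a::metric_space set"
  assumes "countable D" "closure D = UNIV"
  obtains \<B> :: "'a set set" where "countable \<B>" "\<And>B. B \<in> \<B> \<Longrightarrow> open B \<and> B \<noteq> {}"
    "\<And>V. open V \<Longrightarrow> V \<noteq> {} \<Longrightarrow> \<exists>B\<in>\<B>. B \<subseteq> V"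
proof
  define \<B> where "\<B> = (\<lambda>(d, r :: nat). ball d (1 / Suc r)) ` (D \<times> UNIV)"
  show "countable \<B>"
    unfolding \<B>_def using assms by (intro countable_image countable_SIGMA) auto
  show "open B \<and> B \<noteq> {}" if "B \<in> \<B>" for B
    using that unfolding \<B>_def by (auto simp: ball_eq_empty)
  show "\<exists>B\<in>\<B>. B \<subseteq> V" if V: "open V" "V \<noteq> {}" for V
  proof -
    obtain x e where e: "e > 0" "ball x e \<subseteq> V"
      using V by (meson all_not_in_conv openE)
    obtain r :: nat where r: "1 / Suc r < e / 2"
      using e nat_approx_posE[of "e / 2"] by (metis half_gt_zero)
    have "x \<in> closure D" using assms by simp
    then obtain d where d: "d \<in> D" "dist d x < e / 2"
      using e unfolding closure_approachable by (meson half_gt_zero)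
    have "ball d (1 / Suc r) \<subseteq> ball x e"
    proof
      fix y assume "y \<in> ball d (1 / Suc r)"
      then have "dist d y < e / 2" using r by simp
      then show "y \<in> ball x e"
        using d dist_triangle[of x y d] by (simp add: dist_commute)
    qed
    with e d show ?thesis
      unfolding \<B>_def by (intro bexI[of _ "ball d (1 / Suc r)"]) auto
  qed
qed

section \<open>Transitivity of powers and Baire category\<close>

text \<open>The condition at \<open>l = 0\<close> says that \<open>x\<close> itself lies in \<open>V 0\<close>.\<close>

definition d_transitive_powers :: "nat \<Rightarrow> ('a::topological_space \<Rightarrow> 'a) \<Rightarrow> bool"
  where "d_transitive_powers m S \<longleftrightarrow>
    (\<forall>V. (\<forall>l\<le>m. open (V l) \<and> V l \<noteq> {}) \<longrightarrow> (\<exists>n\<ge>1. \<exists>x. \<forall>l\<le>m. (S ^^ (l * n)) x \<in> V l))"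

text \<open>For open \<open>B l\<close>, \<open>G B\<close> collects the vectors whose joint orbit
  visits the box given by \<open>B\<close>. It is open by continuity and, for non-empty
  \<open>B l\<close>, dense by transitivity. Countably many boxes suffice to test density of an
  orbit, so Baire's theorem applies to the intersection.\<close>

lemma densely_d_hypercyclic_powers_if_d_transitive:
  fixes S :: "'a::complete_space \<Rightarrow> 'a" and D :: "'a set"
  assumes D: "countable D" "closure D = UNIV"
    and cont: "continuous_on UNIV S" and trans: "d_transitive_powers m S"
  shows "densely_d_hypercyclic m (\<lambda>l. S ^^ l)"
proof -
  obtain \<B> :: "'a set set" where \<B>: "countable \<B>" "\<And>B. B \<in> \<B> \<Longrightarrow> open B \<and> B \<noteq> {}"
    "\<And>V. open V \<Longrightarrow> V \<noteq> {} \<Longrightarrow> \<exists>B\<in>\<B>. B \<subseteq> V"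
    using separable_open_base[OF D] by blast
  define H where "H = {x. power_space m closure_of {(\<lambda>l\<in>{1..m}. ((S ^^ l) ^^ n) x) | n. True}
                = topspace (power_space m)}"
  define G where "G B = (\<Union>n. \<Inter>l\<in>{1..m}. (S ^^ (l * n)) -` B l)" for B
  have cont_pow: "continuous_on UNIV (S ^^ k)" for k
  proof (induction k)
    case (Suc k)
    then show ?case
      using continuous_on_compose2[OF cont Suc] by (simp add: o_def)
  qed (simp add: id_def)
  have open_G: "open (G B)" if "\<And>l. l \<in> {1..m} \<Longrightarrow> open (B l)" for B
    unfolding G_def using that by (intro open_UN open_INT ballI open_vimage cont_pow) auto
  have dense_G: "closure (G B) = UNIV" if B: "\<And>l. l \<in> {1..m} \<Longrightarrow> open (B l) \<and> B l \<noteq> {}" for B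
  proof -
    have "U \<inter> G B \<noteq> {}" if U: "open U" "U \<noteq> {}" for U
    proof -
      \<comment> \<open>Time \<open>0\<close> is free in \<open>B\<close>; prescribing
        \<open>U\<close> there makes transitivity produce a point of \<open>U\<close>
        itself.\<close>
      have "\<forall>l\<le>m. open ((B(0 := U)) l) \<and> (B(0 := U)) l \<noteq> {}"
        using B U by auto
      then obtain n x where nx: "\<forall>l\<le>m. (S ^^ (l * n)) x \<in> (B(0 := U)) l"
        using trans unfolding d_transitive_powers_def by blast
      then have "x \<in> U"
        by (auto dest: spec[of _ 0])
      moreover have "(S ^^ (l * n)) x \<in> B l" if "l \<in> {1..m}" for l
        using nx that by (auto dest: spec[of _ l])
      then have "x \<in> G B"
        unfolding G_def by blast
      ultimately show ?thesis by blast
    qed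
    \<comment> \<open>This open set misses \<open>G B\<close>, so it must be empty.\<close>
    from this[of "- closure (G B)"] show ?thesis
      using closure_subset[of "G B"] by auto
  qed
  define \<G> where "\<G> = G ` PiE {1..m} (\<lambda>_. \<B>)"
  have "\<Inter>\<G> \<subseteq> H"
  proof
    fix x assume x: "x \<in> \<Inter>\<G>"
    have "\<exists>a\<in>{(\<lambda>l\<in>{1..m}. ((S ^^ l) ^^ n) x) | n. True}. \<forall>l\<in>{1..m}. a l \<in> V l"
      if V: "\<forall>l\<in>{1..m}. open (V l) \<and> V l \<noteq> {}" for V
    proof -
      have "\<forall>l\<in>{1..m}. \<exists>B\<in>\<B>. B \<subseteq> V l"
        using V \<B>(3) by blast
      then obtain B where B: "\<And>l. l \<in> {1..m} \<Longrightarrow> B l \<in> \<B> \<and> B l \<subseteq> V l"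
        by metis
      \<comment> \<open>The family \<open>\<G>\<close> is indexed by extensional functions only,
        which keeps it countable.\<close>
      then have "x \<in> G (restrict B {1..m})"
        using x unfolding \<G>_def by (auto simp: restrict_PiE_iff)
      then obtain n where "\<forall>l\<in>{1..m}. (S ^^ (l * n)) x \<in> B l"
        unfolding G_def by auto
      then have "(S ^^ (l * n)) x \<in> V l" if "l \<in> {1..m}" for l
        using B[OF that] that by blast
      then show ?thesis
        by (intro bexI[of _ "\<lambda>l\<in>{1..m}. ((S ^^ l) ^^ n) x"]) (auto simp: funpow_mult)
    qed
    then show "x \<in> H"
      unfolding H_def mem_Collect_eq by (subst power_space_dense_iff) auto
  qed
  moreover have "closure (\<Inter>\<G>) = UNIV"
  proof -
    have "Met_TC.mtopology closure_of \<Inter>\<G> = (UNIV :: 'a set)"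
    proof (rule Met_TC.metric_Baire_category)
      show "Met_TC.mcomplete TYPE('a)"
        by (simp add: mcomplete_iff_complete complete_UNIV)
      show "countable \<G>"
        unfolding \<G>_def using \<B> by (intro countable_image countable_PiE) auto
      show "openin Met_TC.mtopology T \<and> Met_TC.mtopology closure_of T = UNIV" if "T \<in> \<G>" for T
        using that open_G dense_G \<B>(2) unfolding \<G>_def by (fastforce simp: PiE_iff)
    qed
    then show ?thesis by simp
  qed
  ultimately show ?thesis
    unfolding densely_d_hypercyclic_def H_def[symmetric] using closure_mono by blast
qed

lemma multiply_recurrent_if_d_transitive:
  assumes "\<And>m. m \<ge> 1 \<Longrightarrow> d_transitive_powers m S"
  shows "topologically_multiply_recurrent S"
  unfolding topologically_multiply_recurrent_def
proof (intro allI impI)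
  fix U :: "'a set" and m :: nat
  assume U: "open U \<and> U \<noteq> {}" and "1 \<le> m"
  then obtain n x where n: "n \<ge> 1" and nx: "\<forall>l\<le>m. (S ^^ (l * n)) x \<in> U"
    using assms[of m] unfolding d_transitive_powers_def by (meson spec[of _ "\<lambda>_. U"])
  then have "x \<in> U \<inter> (\<Inter>j\<in>{1..m}. (S ^^ (j * n)) -` U)"
    by (auto dest: spec[of _ 0])
  with n show "\<exists>k\<ge>1. U \<inter> (\<Inter>j\<in>{1..m}. (S ^^ (j * k)) -` U) \<noteq> {}"
    by blast
qed

text \<open>The hypothesis matters for \<open>n = 0\<close>, where the left side is \<open>x\<close>
  and the right side its restriction to \<open>{1..m}\<close>.\<close>

lemma direct_sum_op_power:
  assumes "x \<in> PiE {1..m} (\<lambda>_. UNIV)"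
  shows "(direct_sum_op m Ts ^^ n) x = (\<lambda>l\<in>{1..m}. (Ts l ^^ n) (x l))"
proof (induction n)
  case 0
  then show ?case using assms by (simp add: PiE_restrict)
qed (auto simp: direct_sum_op_def)

lemma hypercyclic_direct_sum_if_densely_d_hypercyclic:
  assumes "densely_d_hypercyclic m Ts"
  shows "hypercyclic_on (power_space m) (direct_sum_op m Ts)"
proof -
  \<comment> \<open>A set with closure \<open>UNIV\<close> is non-empty. One vector of it, repeated
    in every coordinate, has a dense orbit.\<close>
  obtain x where x: "power_space m closure_of {(\<lambda>l\<in>{1..m}. (Ts l ^^ n) x) | n. True}
                = topspace (power_space m)"
    using assms unfolding densely_d_hypercyclic_def by force
  have "(direct_sum_op m Ts ^^ n) (\<lambda>l\<in>{1..m}. x) = (\<lambda>l\<in>{1..m}. (Ts l ^^ n) x)" for n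
    by (subst direct_sum_op_power) auto
  with x show ?thesis
    unfolding hypercyclic_on_def by (intro bexI[of _ "\<lambda>l\<in>{1..m}. x"]) auto
qed

section \<open>Powers of a bilateral weighted shift\<close>

locale weighted_shift =
  fixes w :: "int \<Rightarrow> real" and T :: "ell2_int \<Rightarrow> ell2_int"
  assumes shift: "bilateral_weighted_shift w T"
begin

lemma w_pos: "w n > 0"
  using shift by (simp add: bilateral_weighted_shift_def)

lemma w_bounded: obtains K where "K > 0" "\<And>n. w n \<le> K"
proof -
  obtain K where K: "\<And>n. \<bar>w n\<bar> \<le> K"
    using shift by (auto simp: bilateral_weighted_shift_def bounded_iff)
  show thesis
    using K[of 0] K w_pos by (intro that[of K]) (auto intro: less_le_trans order_trans[OF abs_ge_self])
qed

lemma bounded_linear_T: "bounded_linear T"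
  using shift by (simp add: bilateral_weighted_shift_def bounded_clinear_def)

lemma T_scaleC: "T (c *\<^sub>C x) = c *\<^sub>C T x"
  using shift by (simp add: bilateral_weighted_shift_def bounded_clinear_def)

lemma T_basis_vec: "T (basis_vec n) = of_real (w n) *\<^sub>C basis_vec (n - 1)"
  using shift by (simp add: bilateral_weighted_shift_def)

lemma T_sum: "T (\<Sum>i\<in>I. x i) = (\<Sum>i\<in>I. T (x i))"
  by (rule linear_sum[OF bounded_linear.linear[OF bounded_linear_T]])

text \<open>The shift is prescribed on basis vectors only. The formula holds for truncations by
  linearity and passes to the limit by continuity.\<close>

lemma coord_T: "coord (T x) n = of_real (w (n + 1)) * coord x (n + 1)"
proof (rule tendsto_unique)
  show "((\<lambda>F. coord (T (truncate_ell2 F x)) n) \<longlongrightarrow> coord (T x) n) (finite_subsets_at_top UNIV)"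
    by (intro bounded_linear.tendsto[OF bounded_linear_coord]
        bounded_linear.tendsto[OF bounded_linear_T] truncate_ell2_tendsto)
  have "coord (T (truncate_ell2 F x)) n = of_real (w (n + 1)) * coord (truncate_ell2 F x) (n + 1)"
    if "finite F" for F
  proof -
    have "coord (T (truncate_ell2 F x)) n
        = (\<Sum>j\<in>F. if j = n + 1 then of_real (w j) * coord x j else 0)"
      unfolding truncate_ell2_def T_sum coord_sum
      by (intro sum.cong) (auto simp: T_scaleC T_basis_vec coord_basis_vec)
    then show ?thesis
      using that by (simp add: coord_truncate_ell2)
  qed
  then have "\<forall>\<^sub>F F in finite_subsets_at_top UNIV.
      of_real (w (n + 1)) * coord (truncate_ell2 F x) (n + 1) = coord (T (truncate_ell2 F x)) n"
    by (intro eventually_finite_subsets_at_top_weakI) simp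
  moreover have "((\<lambda>F. of_real (w (n + 1)) * coord (truncate_ell2 F x) (n + 1))
      \<longlongrightarrow> of_real (w (n + 1)) * coord x (n + 1)) (finite_subsets_at_top UNIV)"
    by (intro tendsto_mult_left bounded_linear.tendsto[OF bounded_linear_coord] truncate_ell2_tendsto)
  ultimately show "((\<lambda>F. coord (T (truncate_ell2 F x)) n) \<longlongrightarrow> of_real (w (n + 1)) * coord x (n + 1))
      (finite_subsets_at_top UNIV)"
    by (rule Lim_transform_eventually[rotated])
qed simp

section \<open>Telescoping of weight products\<close>

text \<open>In the quotient one of the two products is empty.\<close>

definition W :: "int \<Rightarrow> real"
  where "W n = (\<Prod>i\<in>{1..n}. w i) / (\<Prod>i\<in>{n + 1..0}. w i)"

lemma W_pos: "W n > 0"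
  unfolding W_def by (intro divide_pos_pos prod_pos) (auto simp: w_pos)

lemma W_rec: "W n = w n * W (n - 1)"
proof (cases "n \<ge> 1")
  case True
  then have "{1..n} = insert n {1..n - 1}" by auto
  with True show ?thesis by (simp add: W_def)
next
  case False
  then have "{n..0} = insert n {n + 1..0}" by auto
  with False w_pos[of n] show ?thesis by (simp add: W_def)
qed

lemma prod_forward: "(\<Prod>i=1..N. w (j + int i)) = W (j + int N) / W j"
proof (induction N)
  case 0
  then show ?case using W_pos[of j] by simp
next
  case (Suc N)
  then show ?case using W_rec[of "j + int (Suc N)"] by (simp add: ac_simps)
qed

lemma prod_backward: "(\<Prod>i<N. w (j - int i)) = W j / W (j - int N)"
proof (induction N)
  case 0
  then show ?case using W_pos[of j] by simp
next
  case (Suc N)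
  then show ?case using W_rec[of "j - int N"] W_pos[of "j - int N - 1"] w_pos[of "j - int N"]
    by (simp add: field_simps)
qed

lemma coord_T_power: "coord ((T ^^ N) x) j = of_real (W (j + int N) / W j) * coord x (j + int N)"
proof (induction N arbitrary: j)
  case 0
  then show ?case using W_pos[of j] by simp
next
  case (Suc N)
  have "w (j + 1) = W (j + 1) / W j"
    using W_rec[of "j + 1"] W_pos[of j] by simp
  then show ?case
    using Suc[of "j + 1"] W_pos[of "j + 1"] by (simp add: coord_T ac_simps)
qed

text \<open>The condition (iv), in telescoped form.\<close>

definition weight_condition :: bool
  where "weight_condition \<longleftrightarrow> (\<forall>m q :: nat. \<forall>\<epsilon>>0. \<exists>n\<ge>1. \<forall>j::int. \<bar>j\<bar> \<le> int q \<longrightarrow>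
    (\<forall>l\<in>{1..m}. W (j + int (l * n)) / W j > 1 / \<epsilon> \<and> W j / W (j - int (l * n)) < \<epsilon>))"

lemma weight_condition_iff:
  "weight_condition \<longleftrightarrow> (\<forall>m\<ge>1. \<forall>q\<ge>1. \<forall>\<epsilon>>0. \<exists>n\<ge>1. \<forall>j::int. \<bar>j\<bar> \<le> int q \<longrightarrow>
      (\<forall>l\<in>{1..m}. (\<Prod>i=1..l * n. w (j + int i)) > 1 / \<epsilon> \<and>
                   (\<Prod>i=0..l * n - 1. w (j - int i)) < \<epsilon>))"
proof -
  define P where "P m q \<epsilon> n \<longleftrightarrow> (\<forall>j::int. \<bar>j\<bar> \<le> int q \<longrightarrow>
    (\<forall>l\<in>{1..m}. W (j + int (l * n)) / W j > 1 / \<epsilon> \<and> W j / W (j - int (l * n)) < \<epsilon>))" for m q n :: nat and \<epsilon>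
  \<comment> \<open>For \<open>N = 0\<close> truncated subtraction would give \<open>{0}\<close> on
    the left; the lengths \<open>l * n\<close> below are positive.\<close>
  have "{0..N - 1} = {..<N}" if "N > 0" for N :: nat
    using that by (cases N) (auto simp: atLeast0AtMost lessThan_Suc_atMost)
  then have "{0..l * n - 1} = {..<l * n}" if "l \<in> {1..m}" "n \<ge> 1" for l m n :: nat
    using that by simp
  then have "(\<forall>m\<ge>1. \<forall>q\<ge>1. \<forall>\<epsilon>>0. \<exists>n\<ge>1. \<forall>j::int. \<bar>j\<bar> \<le> int q \<longrightarrow>
      (\<forall>l\<in>{1..m}. (\<Prod>i=1..l * n. w (j + int i)) > 1 / \<epsilon> \<and>
                   (\<Prod>i=0..l * n - 1. w (j - int i)) < \<epsilon>)) \<longleftrightarrow>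
      (\<forall>m\<ge>1. \<forall>q\<ge>1. \<forall>\<epsilon>>0. \<exists>n\<ge>1. P m q \<epsilon> n)"
    unfolding P_def prod_forward[symmetric] prod_backward[symmetric]
    by (intro arg_cong[where f = All] arg_cong[where f = Ex] ext imp_cong conj_cong refl ball_cong) auto
  also have "\<dots> \<longleftrightarrow> (\<forall>m q. \<forall>\<epsilon>>0. \<exists>n\<ge>1. P m q \<epsilon> n)"
  proof (intro iffI allI impI)
    fix m q :: nat and \<epsilon> :: real
    assume *: "\<forall>m\<ge>1. \<forall>q\<ge>1. \<forall>\<epsilon>>0. \<exists>n\<ge>1. P m q \<epsilon> n" and "\<epsilon> > 0"
    \<comment> \<open>The successors reach the values \<open>m = 0\<close> and \<open>q = 0\<close>,
      which the telescoped form includes.\<close>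
    then obtain n where "n \<ge> 1" "P (Suc m) (Suc q) \<epsilon> n"
      by (metis le_add1 plus_1_eq_Suc)
    then show "\<exists>n\<ge>1. P m q \<epsilon> n"
      unfolding P_def by (intro exI[of _ n]) auto
  qed blast
  finally show ?thesis
    unfolding weight_condition_def P_def by simp
qed

text \<open>Replacing \<open>m\<close> by \<open>m * (M + 1)\<close> and \<open>n\<close> by \<open>(M + 1) * n\<close> makes the return time larger
  than any prescribed \<open>M\<close>.\<close>

lemma weight_condition_large:
  assumes weight_condition "\<epsilon> > 0"
  obtains n where "n > M" "\<And>j l. \<bar>j\<bar> \<le> int q \<Longrightarrow> l \<in> {1..m} \<Longrightarrow>
      W (j + int (l * n)) / W j > 1 / \<epsilon> \<and> W j / W (j - int (l * n)) < \<epsilon>"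
proof -
  obtain n where n: "n \<ge> 1" "\<forall>j::int. \<bar>j\<bar> \<le> int q \<longrightarrow> (\<forall>l\<in>{1..m * Suc M}.
      W (j + int (l * n)) / W j > 1 / \<epsilon> \<and> W j / W (j - int (l * n)) < \<epsilon>)"
    using assms unfolding weight_condition_def by blast
  show thesis
  proof (rule that[of "Suc M * n"])
    show "Suc M * n > M"
      using mult_le_mono2[OF n(1), of "Suc M"] by simp
    fix j :: int and l :: nat
    assume j: "\<bar>j\<bar> \<le> int q" and l: "l \<in> {1..m}"
    have "l * Suc M \<in> {1..m * Suc M}"
      using l mult_le_mono1[of l m "Suc M"] by auto
    from n(2)[rule_format, OF j this]
    show "W (j + int (l * (Suc M * n))) / W j > 1 / \<epsilon> \<and> W j / W (j - int (l * (Suc M * n))) < \<epsilon>"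
      by (simp only: mult.assoc)
  qed
qed

subsection \<open>From the weight condition to transitivity\<close>

text \<open>The two-sided orbit of \<open>e\<^sub>j\<close>: for \<open>d \<ge> 0\<close> this is \<open>T\<^sup>d e\<^sub>j\<close>, for \<open>d < 0\<close> the preimage of
  \<open>e\<^sub>j\<close> under \<open>T\<^bsup>-d\<^esup>\<close> on the line of \<open>e\<^bsub>j-d\<^esub>\<close>.\<close>

definition shifted_vec :: "int \<Rightarrow> int \<Rightarrow> ell2_int"
  where "shifted_vec d j = of_real (W j / W (j - d)) *\<^sub>C basis_vec (j - d)"

lemma shifted_vec_0: "shifted_vec 0 j = basis_vec j"
  using W_pos[of j] by (intro ell2_int_eqI) (simp add: shifted_vec_def)

lemma T_power_shifted_vec: "(T ^^ k) (shifted_vec d j) = shifted_vec (d + int k) j"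
proof (induction k)
  case (Suc k)
  have "T (shifted_vec e j) = shifted_vec (e + 1) j" for e
    using W_rec[of "j - e"] W_pos[of "j - e"] W_pos[of "j - e - 1"] w_pos[of "j - e"]
    by (intro ell2_int_eqI)
       (simp add: shifted_vec_def T_scaleC T_basis_vec coord_basis_vec diff_diff_eq field_simps)
  with Suc show ?case by (simp add: ac_simps)
qed simp

lemma norm_shifted_vec: "norm (shifted_vec d j) = W j / W (j - d)"
  using W_pos[of j] W_pos[of "j - d"] by (simp add: shifted_vec_def norm_scaleC norm_divide del: of_real_divide)

lemma T_power_sum: "(T ^^ k) (\<Sum>i\<in>I. x i) = (\<Sum>i\<in>I. (T ^^ k) (x i))"
  by (induction k) (simp_all add: T_sum)

lemma T_power_scaleC: "(T ^^ k) (c *\<^sub>C x) = c *\<^sub>C (T ^^ k) x"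
  by (induction k) (simp_all add: T_scaleC)

lemma weight_condition_imp_d_transitive:
  assumes wc: weight_condition
  shows "d_transitive_powers m T"
  unfolding d_transitive_powers_def
proof (intro allI impI)
  fix V :: "nat \<Rightarrow> ell2_int set"
  assume V: "\<forall>l\<le>m. open (V l) \<and> V l \<noteq> {}"
  define y where "y l = (SOME x. x \<in> V l)" for l
  have y: "y l \<in> V l" if "l \<le> m" for l
    using V that by (simp add: y_def some_in_eq)
  \<comment> \<open>One set \<open>F\<close> has to serve all \<open>m + 1\<close> targets, and
    below one radius \<open>e\<close> likewise; both come from finite conjunctions of eventual
    properties.\<close>
  have "\<forall>\<^sub>F F in finite_subsets_at_top UNIV. finite F \<and> (\<forall>l\<in>{..m}. truncate_ell2 F (y l) \<in> V l)"
    using V y by (intro eventually_conj eventually_ball_finite ballI topological_tendstoD[OF truncate_ell2_tendsto])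
      (auto intro: eventually_finite_subsets_at_top_weakI)
  then obtain F where F: "finite F" "\<forall>l\<in>{..m}. truncate_ell2 F (y l) \<in> V l"
    using eventually_happens'[OF finite_subsets_at_top_neq_bot] by blast
  define z where "z l = truncate_ell2 F (y l)" for l
  have "\<forall>l\<in>{..m}. \<forall>\<^sub>F e in at_right 0. ball (z l) e \<subseteq> V l"
  proof
    fix l assume "l \<in> {..m}"
    then obtain e where "e > 0" "ball (z l) e \<subseteq> V l"
      using V F(2) open_contains_ball[of "V l"] unfolding z_def by blast
    then show "\<forall>\<^sub>F e in at_right 0. ball (z l) e \<subseteq> V l"
      unfolding eventually_at_right_field by (intro exI[of _ e]) auto
  qed
  then have "\<forall>\<^sub>F e :: real in at_right 0. e > 0 \<and> (\<forall>l\<in>{..m}. ball (z l) e \<subseteq> V l)"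
    by (intro eventually_conj eventually_ball_finite eventually_at_right_less) auto
  then obtain e :: real where e: "e > 0" "\<forall>l\<in>{..m}. ball (z l) e \<subseteq> V l"
    using eventually_happens'[OF trivial_limit_at_right_real] by blast
  define C where "C = (\<Sum>l\<le>m. \<Sum>j\<in>F. norm (coord (y l) j))"
  have C: "C \<ge> 0"
    unfolding C_def by (intro sum_nonneg) auto
  \<comment> \<open>The error terms together have norm at most \<open>C * \<epsilon>\<close>. The
    \<open>+ 1\<close> keeps the denominator positive and the bound by \<open>e\<close>
    strict.\<close>
  define \<epsilon> where "\<epsilon> = e / (C + 1)"
  have \<epsilon>: "\<epsilon> > 0" "C * \<epsilon> < e"
    using e C by (auto simp: \<epsilon>_def field_simps)
  define q where "q = nat (\<Sum>j\<in>F. \<bar>j\<bar>)"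
  have q: "\<bar>j\<bar> \<le> int q" if "j \<in> F" for j
    using member_le_sum[OF that, of abs] F(1) by (simp add: q_def sum_nonneg)
  obtain n where n: "n > 0" "\<And>j l. \<bar>j\<bar> \<le> int q \<Longrightarrow> l \<in> {1..m} \<Longrightarrow>
      W (j + int (l * n)) / W j > 1 / \<epsilon> \<and> W j / W (j - int (l * n)) < \<epsilon>"
    using weight_condition_large[OF wc \<epsilon>(1), of 0 q m] by metis
  \<comment> \<open>At positive times this is the second inequality of the weight condition; at
    negative times it is the reciprocal of the first.\<close>
  have small: "norm (shifted_vec (int (k * n) - int (l * n)) j) \<le> \<epsilon>"
    if "k \<le> m" "l \<le> m" "k \<noteq> l" "j \<in> F" for k l j
  proof (cases "k > l")
    case True
    then have eq: "int (k * n) - int (l * n) = int ((k - l) * n)"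
      by (simp add: of_nat_diff algebra_simps)
    have "k - l \<in> {1..m}"
      using True that by auto
    from n(2)[OF q[OF that(4)] this] show ?thesis
      unfolding norm_shifted_vec eq by simp
  next
    case False
    then have eq: "int (k * n) - int (l * n) = - int ((l - k) * n)"
      using that by (simp add: of_nat_diff algebra_simps)
    have "l - k \<in> {1..m}"
      using False that by auto
    from n(2)[OF q[OF that(4)] this] have "1 / \<epsilon> < W (j + int ((l - k) * n)) / W j"
      by blast
    then have "W j / W (j + int ((l - k) * n)) < \<epsilon>"
      using W_pos[of j] W_pos[of "j + int ((l - k) * n)"] \<epsilon>(1) by (simp add: field_simps)
    then show ?thesis
      unfolding norm_shifted_vec eq by simp
  qed
  define x where "x = (\<Sum>l\<le>m. \<Sum>j\<in>F. coord (y l) j *\<^sub>C shifted_vec (- int (l * n)) j)"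
  have "(T ^^ (k * n)) x \<in> V k" if k: "k \<le> m" for k
  proof -
    \<comment> \<open>\<open>g l\<close> is what the summand for \<open>y l\<close> becomes at time
      \<open>k * n\<close>: for \<open>l = k\<close> it has returned to the truncated vector,
      otherwise it is small.\<close>
    define g where "g l = (\<Sum>j\<in>F. coord (y l) j *\<^sub>C shifted_vec (int (k * n) - int (l * n)) j)" for l
    have "(T ^^ (k * n)) x = (\<Sum>l\<le>m. g l)"
      unfolding x_def g_def T_power_sum T_power_scaleC T_power_shifted_vec
      by (simp add: algebra_simps)
    also have "\<dots> = g k + (\<Sum>l\<in>{..m} - {k}. g l)"
      using k by (intro sum.remove) auto
    also have "g k = z k"
      by (simp add: g_def z_def truncate_ell2_def shifted_vec_0)
    finally have "norm ((T ^^ (k * n)) x - z k) = norm (\<Sum>l\<in>{..m} - {k}. g l)"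
      by simp
    also have "\<dots> \<le> (\<Sum>l\<in>{..m} - {k}. \<Sum>j\<in>F. norm (coord (y l) j) * \<epsilon>)"
      unfolding g_def
      by (intro sum_norm_le) (use small k in \<open>auto simp: norm_scaleC intro!: mult_left_mono\<close>)
    also have "\<dots> \<le> (\<Sum>l\<le>m. \<Sum>j\<in>F. norm (coord (y l) j) * \<epsilon>)"
      by (intro sum_mono2 sum_nonneg) (use \<epsilon> in auto)
    also have "\<dots> = C * \<epsilon>"
      by (simp add: C_def sum_distrib_right)
    also have "\<dots> < e" by fact
    finally show ?thesis
      using e(2) k by (auto simp: dist_norm norm_minus_commute subset_iff)
  qed
  then show "\<exists>n\<ge>1. \<exists>x. \<forall>l\<le>m. (T ^^ (l * n)) x \<in> V l"
    using n(1) by (intro exI[of _ n]) auto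
qed


subsection \<open>From near returns to the weight condition\<close>

definition ones_vec :: "nat \<Rightarrow> ell2_int"
  where "ones_vec q = (\<Sum>j\<in>{- int q..int q}. basis_vec j)"

lemma coord_ones_vec: "coord (ones_vec q) j = (if \<bar>j\<bar> \<le> int q then 1 else 0)"
  by (auto simp: ones_vec_def coord_sum coord_basis_vec)

lemma norm_coord_near_ones_vec:
  assumes "dist u (ones_vec q) < \<delta>"
  shows "\<bar>j\<bar> \<le> int q \<Longrightarrow> norm (coord u j) > 1 - \<delta>" "\<bar>j\<bar> > int q \<Longrightarrow> norm (coord u j) < \<delta>"
proof -
  have *: "norm (coord u j - coord (ones_vec q) j) < \<delta>"
    using norm_coord_le[of "u - ones_vec q" j] assms by (simp add: dist_norm)
  show "norm (coord u j) > 1 - \<delta>" if "\<bar>j\<bar> \<le> int q"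
    using * that norm_triangle_ineq2[of 1 "coord u j"]
    by (simp add: coord_ones_vec norm_minus_commute)
  show "norm (coord u j) < \<delta>" if "\<bar>j\<bar> > int q"
    using * that by (simp add: coord_ones_vec)
qed

text \<open>As \<open>N > 2 * q\<close>, both \<open>j + N\<close> and \<open>j - N\<close> lie
  outside the support of \<open>ones_vec q\<close>. The coordinate of \<open>u\<close> at
  \<open>j + N\<close> is below \<open>\<delta>\<close> but is mapped to one above
  \<open>1 - \<delta>\<close>, so the weight quotient exceeds
  \<open>(1 - \<delta>) / \<delta> > 1 / \<epsilon>\<close>. From \<open>j\<close> to
  \<open>j - N\<close> a large coordinate is mapped to a small one.\<close>

lemma weights_of_near_return:
  assumes \<epsilon>: "\<epsilon> > 0" and \<delta>: "0 < \<delta>" "\<delta> < \<epsilon> * (1 - \<delta>)"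
    and u: "dist u (ones_vec q) < \<delta>" "dist ((T ^^ N) u) (ones_vec q) < \<delta>"
    and N: "N > 2 * q" and j: "\<bar>j\<bar> \<le> int q"
  shows "W (j + int N) / W j > 1 / \<epsilon>" "W j / W (j - int N) < \<epsilon>"
proof -
  have far: "\<bar>j + int N\<bar> > int q" "\<bar>j - int N\<bar> > int q"
    using N j by auto
  note pos = W_pos[of j] W_pos[of "j + int N"] W_pos[of "j - int N"]
  have "\<epsilon> * (1 - \<delta>) > 0" using \<delta> by linarith
  then have \<delta>1: "1 - \<delta> > 0" using \<epsilon> by (simp add: zero_less_mult_iff)
  have "1 - \<delta> < norm (coord ((T ^^ N) u) j)"
    using norm_coord_near_ones_vec(1)[OF u(2) j] .
  also have "\<dots> = W (j + int N) / W j * norm (coord u (j + int N))"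
    using pos by (simp add: coord_T_power norm_mult norm_divide)
  also have "\<dots> \<le> W (j + int N) / W j * \<delta>"
    using norm_coord_near_ones_vec(2)[OF u(1) far(1)] pos by (intro mult_left_mono) auto
  finally have "1 - \<delta> < W (j + int N) / W j * \<delta>" .
  then have "\<epsilon> * (1 - \<delta>) < \<epsilon> * (W (j + int N) / W j * \<delta>)"
    using \<epsilon> by (rule mult_strict_left_mono)
  then have "\<delta> * 1 < \<delta> * (\<epsilon> * (W (j + int N) / W j))"
    using \<delta> by (simp add: ac_simps)
  then have "1 < \<epsilon> * (W (j + int N) / W j)"
    using \<delta> by (simp only: mult_less_cancel_left_pos)
  then show "W (j + int N) / W j > 1 / \<epsilon>"
    using \<epsilon> by (simp add: divide_less_eq mult.commute)
  have "W j / W (j - int N) * (1 - \<delta>) \<le> W j / W (j - int N) * norm (coord u j)"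
    using norm_coord_near_ones_vec(1)[OF u(1) j] pos by (intro mult_left_mono) auto
  also have "\<dots> = norm (coord ((T ^^ N) u) (j - int N))"
    using pos by (simp add: coord_T_power norm_mult norm_divide)
  also have "\<dots> < \<delta>"
    using norm_coord_near_ones_vec(2)[OF u(2) far(2)] .
  also have "\<dots> < \<epsilon> * (1 - \<delta>)" by fact
  finally show "W j / W (j - int N) < \<epsilon>"
    using \<delta>1 by (simp only: mult_less_cancel_right_pos)
qed

text \<open>This is the common consequence of (i) and (ii). The vector \<open>u\<close> may depend
  on \<open>l\<close>, as the components of a vector in the direct sum differ.\<close>

lemma weight_condition_if_near_returns:
  assumes "\<And>M q \<delta>. M \<ge> 1 \<Longrightarrow> \<delta> > 0 \<Longrightarrow> \<exists>k\<ge>1. \<forall>l\<in>{1..M}. \<exists>u.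
      dist u (ones_vec q) < \<delta> \<and> dist ((T ^^ (l * k)) u) (ones_vec q) < \<delta>"
  shows weight_condition
  unfolding weight_condition_def
proof (intro allI impI)
  fix m q :: nat and \<epsilon> :: real assume \<epsilon>: "\<epsilon> > 0"
  \<comment> \<open>This solves \<open>\<delta> * (1 + \<epsilon>) = \<epsilon> / 2\<close>, so that
    \<open>\<delta> < \<epsilon> * (1 - \<delta>)\<close>.\<close>
  define \<delta> where "\<delta> = \<epsilon> / (2 * (1 + \<epsilon>))"
  have "\<delta> * (1 + \<epsilon>) = \<epsilon> / 2"
    using \<epsilon> by (simp add: \<delta>_def divide_simps)
  then have "\<delta> < \<epsilon> * (1 - \<delta>)"
    using \<epsilon> by (simp add: algebra_simps)
  moreover have "0 < \<delta>"
    using \<epsilon> by (simp add: \<delta>_def)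
  ultimately have \<delta>: "0 < \<delta>" "\<delta> < \<epsilon> * (1 - \<delta>)" by auto
  \<comment> \<open>The factor \<open>2 * q + 1\<close> is moved from the multiplier into the time
    \<open>n\<close> to make it exceed \<open>2 * q\<close>. \<open>Suc m\<close> keeps the range
    non-empty for \<open>m = 0\<close>.\<close>
  obtain k where k: "k \<ge> 1" "\<forall>l\<in>{1..Suc m * (2 * q + 1)}. \<exists>u.
      dist u (ones_vec q) < \<delta> \<and> dist ((T ^^ (l * k)) u) (ones_vec q) < \<delta>"
    using assms[of "Suc m * (2 * q + 1)" \<delta> q] \<delta> by auto
  define n where "n = (2 * q + 1) * k"
  show "\<exists>n\<ge>1. \<forall>j::int. \<bar>j\<bar> \<le> int q \<longrightarrow>
    (\<forall>l\<in>{1..m}. W (j + int (l * n)) / W j > 1 / \<epsilon> \<and> W j / W (j - int (l * n)) < \<epsilon>)"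
  proof (intro exI[of _ n] conjI allI impI ballI)
    have n: "n > 2 * q"
      using mult_le_mono2[OF k(1), of "2 * q + 1"] by (simp add: n_def)
    then show "n \<ge> 1" by simp
    fix j :: int and l :: nat assume j: "\<bar>j\<bar> \<le> int q" and l: "l \<in> {1..m}"
    have "l * (2 * q + 1) \<le> Suc m * (2 * q + 1)"
      using l by (intro mult_le_mono1) auto
    then have "l * (2 * q + 1) \<in> {1..Suc m * (2 * q + 1)}"
      using l by auto
    moreover have "l * (2 * q + 1) * k = l * n"
      by (simp only: n_def mult.assoc)
    ultimately obtain u where u:
      "dist u (ones_vec q) < \<delta>" "dist ((T ^^ (l * n)) u) (ones_vec q) < \<delta>"
      using k(2) by metis
    have "1 * n \<le> l * n"
      using l by (intro mult_le_mono1) auto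
    with n have "l * n > 2 * q" by linarith
    from weights_of_near_return[OF \<epsilon> \<delta> u this j]
    show "W (j + int (l * n)) / W j > 1 / \<epsilon>" "W j / W (j - int (l * n)) < \<epsilon>" .
  qed
qed

lemma weight_condition_if_multiply_recurrent:
  assumes "topologically_multiply_recurrent T"
  shows weight_condition
proof (rule weight_condition_if_near_returns)
  fix M q :: nat and \<delta> :: real assume "M \<ge> 1" "\<delta> > 0"
  then have "\<exists>k\<ge>1. ball (ones_vec q) \<delta> \<inter> (\<Inter>j\<in>{1..M}. (T ^^ (j * k)) -` ball (ones_vec q) \<delta>) \<noteq> {}"
    using assms unfolding topologically_multiply_recurrent_def by simp
  then show "\<exists>k\<ge>1. \<forall>l\<in>{1..M}. \<exists>u.
      dist u (ones_vec q) < \<delta> \<and> dist ((T ^^ (l * k)) u) (ones_vec q) < \<delta>"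
    by (auto simp: dist_commute) blast
qed

text \<open>A dense orbit visits two disjoint small balls close to \<open>ones_vec q\<close>, at different times.\<close>

lemma weight_condition_if_hypercyclic:
  assumes "\<And>m. m \<ge> 1 \<Longrightarrow> hypercyclic_on (power_space m) (direct_sum_op m (\<lambda>l. T ^^ l))"
  shows weight_condition
proof (rule weight_condition_if_near_returns)
  fix M q :: nat and \<delta> :: real assume M: "M \<ge> 1" and \<delta>: "\<delta> > 0"
  obtain x where x: "x \<in> topspace (power_space M)"
    and dense: "power_space M closure_of {(direct_sum_op M (\<lambda>l. T ^^ l) ^^ n) x | n. True}
      = topspace (power_space M)"
    using assms[OF M] unfolding hypercyclic_on_def by blast
  have orbit: "(direct_sum_op M (\<lambda>l. T ^^ l) ^^ n) x = (\<lambda>l\<in>{1..M}. (T ^^ (l * n)) (x l))" for n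
    using x by (subst direct_sum_op_power) (auto simp: funpow_mult)
  have visit: "\<exists>n. \<forall>l\<in>{1..M}. (T ^^ (l * n)) (x l) \<in> B" if "open B" "B \<noteq> {}" for B
  proof -
    have "\<exists>a\<in>{(\<lambda>l\<in>{1..M}. (T ^^ (l * n)) (x l)) | n. True}. \<forall>l\<in>{1..M}. a l \<in> B"
      using dense[unfolded orbit] that by (subst (asm) power_space_dense_iff) auto
    then obtain n where "\<forall>l\<in>{1..M}. (\<lambda>l\<in>{1..M}. (T ^^ (l * n)) (x l)) l \<in> B"
      by blast
    then have "\<forall>l\<in>{1..M}. (T ^^ (l * n)) (x l) \<in> B"
      by simp
    then show ?thesis by blast
  qed
  \<comment> \<open>At distance \<open>\<delta> / 2\<close>, the balls of radius
    \<open>\<delta> / 4\<close> about \<open>y\<close> and \<open>ones_vec q\<close> are disjoint,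
    yet both lie within \<open>\<delta>\<close> of \<open>ones_vec q\<close>.\<close>
  define y where "y = ones_vec q + (\<delta> / 2) *\<^sub>R basis_vec 0"
  have y: "dist y (ones_vec q) = \<delta> / 2"
    using \<delta> by (simp add: y_def dist_norm)
  obtain a where a: "\<forall>l\<in>{1..M}. (T ^^ (l * a)) (x l) \<in> ball (ones_vec q) (\<delta> / 4)"
    using visit[of "ball (ones_vec q) (\<delta> / 4)"] \<delta> by auto
  obtain b where b: "\<forall>l\<in>{1..M}. (T ^^ (l * b)) (x l) \<in> ball y (\<delta> / 4)"
    using visit[of "ball y (\<delta> / 4)"] \<delta> by auto
  have "a \<noteq> b"
  proof
    assume "a = b"
    with a b M have "(T ^^ a) (x 1) \<in> ball (ones_vec q) (\<delta> / 4) \<inter> ball y (\<delta> / 4)"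
      by (auto dest!: bspec[of _ _ 1])
    then have "dist y (ones_vec q) < \<delta> / 2"
      using dist_triangle[of y "ones_vec q" "(T ^^ a) (x 1)"] by (simp add: dist_commute)
    with y show False by simp
  qed
  have near: "dist ((T ^^ (l * c)) (x l)) (ones_vec q) < \<delta>" if "c = a \<or> c = b" "l \<in> {1..M}" for c l
  proof -
    have "dist (ones_vec q) ((T ^^ (l * a)) (x l)) < \<delta> / 4" "dist y ((T ^^ (l * b)) (x l)) < \<delta> / 4"
      using a b that by auto
    then show ?thesis
      using that(1) y \<delta> dist_triangle[of "(T ^^ (l * b)) (x l)" "ones_vec q" y]
      unfolding dist_commute[of "ones_vec q"] dist_commute[of y "(T ^^ (l * b)) (x l)"]
      by (elim disjE; simp only:; linarith)
  qed
  \<comment> \<open>The visit at the earlier time, \<open>(T ^^ (l * s)) (x l)\<close>, serves as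
    \<open>u\<close>, and \<open>t - s\<close> as the return time common to all
    \<open>l\<close>.\<close>
  define s t where "s = min a b" and "t = max a b"
  have st: "t = s + (t - s)" "t - s \<ge> 1" "s = a \<or> s = b" "t = a \<or> t = b"
    using \<open>a \<noteq> b\<close> by (auto simp: s_def t_def)
  have "(T ^^ (l * (t - s))) ((T ^^ (l * s)) (x l)) = (T ^^ (l * t)) (x l)" for l
    by (subst (2) st(1)) (simp add: distrib_left funpow_add add.commute[of "l * s"])
  then show "\<exists>k\<ge>1. \<forall>l\<in>{1..M}. \<exists>u.
      dist u (ones_vec q) < \<delta> \<and> dist ((T ^^ (l * k)) u) (ones_vec q) < \<delta>"
    using near st by (intro exI[of _ "t - s"] conjI ballI) metis+
qed

subsection \<open>Invertible shifts\<close>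

text \<open>The condition (v), in telescoped form. The second product in (v) has \<open>l * n + 1\<close> factors.\<close>

definition divergence_condition :: bool
  where "divergence_condition \<longleftrightarrow> (\<forall>m\<ge>1. \<exists>nk :: nat \<Rightarrow> nat. strict_mono nk \<and> (\<forall>k. nk k \<ge> 1) \<and>
    (\<forall>l\<in>{1..m}.
      filterlim (\<lambda>k. W (int (l * nk k)) / W 0) at_top sequentially \<and>
      filterlim (\<lambda>k. W (- int (Suc (l * nk k))) / W 0) at_top sequentially))"

lemma divergence_condition_iff:
  "divergence_condition \<longleftrightarrow> (\<forall>m\<ge>1. \<exists>nk :: nat \<Rightarrow> nat. strict_mono nk \<and> (\<forall>k. nk k \<ge> 1) \<and>
    (\<forall>l\<in>{1..m}.
      filterlim (\<lambda>k. \<Prod>i=1..l * nk k. w (int i)) at_top sequentially \<and>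
      filterlim (\<lambda>k. \<Prod>i=0..l * nk k. 1 / w (- int i)) at_top sequentially))"
proof -
  have "(\<Prod>i=1..N. w (int i)) = W (int N) / W 0" for N
    using prod_forward[of 0 N] by simp
  moreover have "(\<Prod>i=0..N. 1 / w (- int i)) = W (- int (Suc N)) / W 0" for N
    using prod_backward[of 0 "Suc N"]
    by (simp add: prod_dividef atLeast0AtMost lessThan_Suc_atMost del: of_nat_Suc prod.lessThan_Suc)
  ultimately show ?thesis
    unfolding divergence_condition_def by simp
qed

text \<open>Taking \<open>q = 0\<close> and the bound \<open>1 / Suc k\<close> at stage
  \<open>k\<close>, the times are chosen recursively, each beyond the previous one.\<close>

lemma weight_condition_imp_divergence_condition:
  assumes wc: weight_condition
  shows divergence_condition
  unfolding divergence_condition_def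
proof (intro allI impI)
  fix m :: nat
  define P where "P k n \<longleftrightarrow> n \<ge> 1 \<and> (\<forall>l\<in>{1..m}. W (int (l * n)) / W 0 > real (Suc k) \<and>
    W (- int (l * n)) / W 0 > real (Suc k))" for k n
  have large: "\<exists>n>M. P k n" for M k
  proof -
    obtain n where n: "n > M" "\<And>j l. \<bar>j\<bar> \<le> int 0 \<Longrightarrow> l \<in> {1..m} \<Longrightarrow>
      W (j + int (l * n)) / W j > 1 / (1 / real (Suc k)) \<and> W j / W (j - int (l * n)) < 1 / real (Suc k)"
      by (rule weight_condition_large[OF wc, of "1 / real (Suc k)" M 0 m]) auto
    have "W (int (l * n)) / W 0 > real (Suc k) \<and> W (- int (l * n)) / W 0 > real (Suc k)"
      if "l \<in> {1..m}" for l
      using n(2)[of 0 l] that W_pos[of 0] W_pos[of "- int (l * n)"]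
      by (simp add: field_simps del: of_nat_Suc of_nat_mult)
    with n(1) show ?thesis
      unfolding P_def by (intro exI[of _ n]) auto
  qed
  have "\<exists>nk. \<forall>k. P k (nk k) \<and> nk k < nk (Suc k)"
    using large by (intro dependent_nat_choice) blast+
  then obtain nk where nk: "\<And>k. P k (nk k)" "\<And>k. nk k < nk (Suc k)"
    by blast
  obtain K where K: "K > 0" "\<And>n. w n \<le> K"
    using w_bounded by blast
  have lim: "filterlim (\<lambda>k. real (Suc k) / c) at_top sequentially" if "c > 0" for c
    using filterlim_tendsto_pos_mult_at_top[OF tendsto_const _
        filterlim_compose[OF filterlim_real_sequentially filterlim_Suc], of "1 / c"] that
    by simp
  show "\<exists>nk :: nat \<Rightarrow> nat. strict_mono nk \<and> (\<forall>k. nk k \<ge> 1) \<and> (\<forall>l\<in>{1..m}.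
      filterlim (\<lambda>k. W (int (l * nk k)) / W 0) at_top sequentially \<and>
      filterlim (\<lambda>k. W (- int (Suc (l * nk k))) / W 0) at_top sequentially)"
  proof (intro exI[of _ nk] conjI allI ballI)
    show "strict_mono nk"
      using nk(2) by (simp add: strict_mono_Suc_iff)
    show "nk k \<ge> 1" for k
      using nk(1)[of k] by (simp add: P_def)
    fix l assume l: "l \<in> {1..m}"
    have "real (Suc k) / 1 \<le> W (int (l * nk k)) / W 0" for k
      using nk(1)[of k] l by (simp add: P_def less_imp_le del: of_nat_Suc of_nat_mult)
    then show "filterlim (\<lambda>k. W (int (l * nk k)) / W 0) at_top sequentially"
      by (intro filterlim_at_top_mono[OF lim[of 1]]) auto
    \<comment> \<open>The second product has one factor more than the weight condition controls; the
      upper bound \<open>K\<close> of the weights limits the loss.\<close>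
    have "real (Suc k) / K \<le> W (- int (Suc (l * nk k))) / W 0" for k
    proof -
      have idx: "- int (Suc (l * nk k)) = - int (l * nk k) - 1"
        by simp
      have "real (Suc k) \<le> W (- int (l * nk k)) / W 0"
        using nk(1)[of k] l by (auto simp: P_def intro: less_imp_le)
      also have "\<dots> = w (- int (l * nk k)) * (W (- int (Suc (l * nk k))) / W 0)"
        using W_rec[of "- int (l * nk k)"] by (simp only: idx times_divide_eq_right)
      also have "\<dots> \<le> K * (W (- int (Suc (l * nk k))) / W 0)"
        using W_pos[of 0] W_pos[of "- int (Suc (l * nk k))"] by (intro mult_right_mono K) auto
      finally show ?thesis
        using K by (simp add: field_simps)
    qed
    then show "filterlim (\<lambda>k. W (- int (Suc (l * nk k))) / W 0) at_top sequentially"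
      by (intro filterlim_at_top_mono[OF lim[OF K(1)]]) auto
  qed
qed

text \<open>The inverse maps \<open>w n\<close> times a unit vector to the unit vector
  \<open>basis_vec n\<close>, so \<open>1 / w n\<close> is at most its norm bound.\<close>

lemma w_bounded_below_if_invertible:
  assumes "invertible_operator T"
  obtains c where "c > 0" "\<And>n. c \<le> w n"
proof -
  obtain S where S: "bounded_clinear S" "S \<circ> T = id"
    using assms unfolding invertible_operator_def by blast
  obtain B where B: "B > 0" "\<And>x. norm (S x) \<le> norm x * B"
    using S(1) bounded_linear.pos_bounded unfolding bounded_clinear_def by blast
  have "1 / B \<le> w n" for n
  proof -
    have "norm (S (T (basis_vec n))) \<le> norm (T (basis_vec n)) * B"
      by (rule B)
    moreover have "S (T (basis_vec n)) = basis_vec n"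
      using S(2) by (simp add: fun_eq_iff)
    ultimately have "1 \<le> w n * B"
      using w_pos[of n] by (simp add: T_basis_vec norm_scaleC)
    then show ?thesis
      using B by (simp add: field_simps)
  qed
  with B(1) show thesis
    by (intro that[of "1 / B"]) auto
qed

text \<open>A unit step of the index changes \<open>W\<close> by a factor between \<open>c\<close>
  and an upper bound \<open>K\<close> of the weights. Induction in both directions covers the fixed
  number of steps \<open>j\<close>.\<close>

lemma W_translate_at_top:
  fixes s :: "nat \<Rightarrow> int"
  assumes c: "c > 0" "\<And>n. c \<le> w n" and s: "filterlim (\<lambda>k. W (s k)) at_top sequentially"
  shows "filterlim (\<lambda>k. W (j + s k)) at_top sequentially"
proof -
  obtain K where K: "K > 0" "\<And>n. w n \<le> K"
    using w_bounded by blast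
  have scale: "filterlim (\<lambda>k. r * f k) at_top sequentially"
    if "r > 0" "filterlim f at_top sequentially" for r :: real and f
    using that by (intro filterlim_tendsto_pos_mult_at_top[OF tendsto_const])
  show ?thesis
  proof (induction j rule: int_induct[where k = 0])
    case base
    then show ?case using s by simp
  next
    case (step1 i)
    show ?case
    proof (rule filterlim_at_top_mono[OF scale[OF c(1) step1(2)]], intro always_eventually allI)
      show "c * W (i + s k) \<le> W (i + 1 + s k)" for k
        using W_rec[of "i + 1 + s k"] c(2)[of "i + 1 + s k"] W_pos[of "i + s k"]
        by (simp add: algebra_simps)
    qed
  next
    case (step2 i)
    have "1 / K > 0" using K by simp
    show ?case
    proof (rule filterlim_at_top_mono[OF scale[OF \<open>1 / K > 0\<close> step2(2)]], intro always_eventually allI)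
      fix k
      have "W (i + s k) \<le> K * W (i - 1 + s k)"
        using W_rec[of "i + s k"] K(2)[of "i + s k"] W_pos[of "i - 1 + s k"]
        by (simp add: algebra_simps)
      then show "1 / K * W (i + s k) \<le> W (i - 1 + s k)"
        using K by (simp add: field_simps)
    qed
  qed
qed

lemma divergence_condition_imp_weight_condition:
  assumes inv: "invertible_operator T" and dc: divergence_condition
  shows weight_condition
  unfolding weight_condition_def
proof (intro allI impI)
  fix m q :: nat and \<epsilon> :: real assume \<epsilon>: "\<epsilon> > 0"
  obtain c where c: "c > 0" "\<And>n. c \<le> w n"
    using w_bounded_below_if_invertible[OF inv] by blast
  \<comment> \<open>The divergence condition speaks of positive \<open>m\<close> only.\<close>
  have "Suc m \<ge> 1" by simp
  from dc[unfolded divergence_condition_def, THEN spec, THEN mp, OF this]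
  obtain nk :: "nat \<Rightarrow> nat" where nk0: "strict_mono nk \<and> (\<forall>k. nk k \<ge> 1) \<and>
    (\<forall>l\<in>{1..Suc m}. filterlim (\<lambda>k. W (int (l * nk k)) / W 0) at_top sequentially \<and>
      filterlim (\<lambda>k. W (- int (Suc (l * nk k))) / W 0) at_top sequentially)"
    by (rule exE)
  note nk = conjunct1[OF conjunct2[OF nk0]] conjunct2[OF conjunct2[OF nk0]]
  have drop: "filterlim f at_top sequentially" if "filterlim (\<lambda>k. f k / W 0) at_top sequentially"
    for f :: "nat \<Rightarrow> real"
  proof -
    have "W 0 \<noteq> 0" using W_pos[of 0] by simp
    then show ?thesis
      using filterlim_tendsto_pos_mult_at_top[OF tendsto_const W_pos[of 0] that] by simp
  qed
  have "\<forall>\<^sub>F k in sequentially. W (j + int (l * nk k)) / W j > 1 / \<epsilon> \<and> W j / W (j - int (l * nk k)) < \<epsilon>"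
    if l: "l \<in> {1..m}" for j l
  proof -
    have "filterlim (\<lambda>k. W (j + int (l * nk k))) at_top sequentially"
      using l by (intro W_translate_at_top[OF c drop[OF conjunct1[OF bspec[OF nk(2)]]]]) auto
    then have "\<forall>\<^sub>F k in sequentially. W (j + int (l * nk k)) > W j / \<epsilon>"
      unfolding filterlim_at_top_dense by blast
    \<comment> \<open>Translating by \<open>j + 1\<close> absorbs the extra factor:
      \<open>j + 1 - Suc (l * nk k) = j - l * nk k\<close>.\<close>
    moreover have "filterlim (\<lambda>k. W (j + 1 + - int (Suc (l * nk k)))) at_top sequentially"
      using l by (intro W_translate_at_top[OF c drop[OF conjunct2[OF bspec[OF nk(2)]]]]) auto
    then have "\<forall>\<^sub>F k in sequentially. W (j + 1 + - int (Suc (l * nk k))) > W j / \<epsilon>"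
      unfolding filterlim_at_top_dense by blast
    then have "\<forall>\<^sub>F k in sequentially. W (j - int (l * nk k)) > W j / \<epsilon>"
      by simp
    ultimately show ?thesis
    proof eventually_elim
      case (elim k)
      then show ?case
        using \<epsilon> W_pos[of j] W_pos[of "j - int (l * nk k)"] by (simp add: field_simps)
    qed
  qed
  \<comment> \<open>Only finitely many pairs \<open>j\<close>, \<open>l\<close> occur, so one
    \<open>k\<close> serves them all.\<close>
  then have ev: "\<forall>\<^sub>F k in sequentially. \<forall>j\<in>{- int q..int q}. \<forall>l\<in>{1..m}.
      W (j + int (l * nk k)) / W j > 1 / \<epsilon> \<and> W j / W (j - int (l * nk k)) < \<epsilon>"
    by (intro eventually_ball_finite ballI finite_atLeastAtMost_int finite_atLeastAtMost)
  from eventually_happens'[OF sequentially_bot ev] obtain k where k: "\<forall>j\<in>{- int q..int q}. \<forall>l\<in>{1..m}.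
      W (j + int (l * nk k)) / W j > 1 / \<epsilon> \<and> W j / W (j - int (l * nk k)) < \<epsilon>"
    by (rule exE)
  show "\<exists>n\<ge>1. \<forall>j::int. \<bar>j\<bar> \<le> int q \<longrightarrow>
    (\<forall>l\<in>{1..m}. W (j + int (l * n)) / W j > 1 / \<epsilon> \<and> W j / W (j - int (l * n)) < \<epsilon>)"
  proof (intro exI[of _ "nk k"] conjI allI impI)
    show "nk k \<ge> 1"
      using nk(1) ..
    fix j :: int assume "\<bar>j\<bar> \<le> int q"
    then have "j \<in> {- int q..int q}" by auto
    then show "\<forall>l\<in>{1..m}. W (j + int (l * nk k)) / W j > 1 / \<epsilon> \<and> W j / W (j - int (l * nk k)) < \<epsilon>"
      by (rule bspec[OF k])
  qed
qed

section \<open>Equivalence of each condition with the weight condition\<close>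

lemma densely_d_hypercyclic_if_weight_condition:
  assumes weight_condition
  shows "densely_d_hypercyclic m (\<lambda>l. T ^^ l)"
proof -
  obtain D :: "ell2_int set" where "countable D" "closure D = UNIV"
    using ell2_int_separable by blast
  then show ?thesis
    using weight_condition_imp_d_transitive[OF assms] bounded_linear_T
    by (intro densely_d_hypercyclic_powers_if_d_transitive)
      (auto intro: linear_continuous_on)
qed

lemma multiply_recurrent_iff_weight_condition:
  "topologically_multiply_recurrent T \<longleftrightarrow> weight_condition"
  using multiply_recurrent_if_d_transitive weight_condition_imp_d_transitive
    weight_condition_if_multiply_recurrent by blast

lemma hypercyclic_iff_weight_condition:
  "(\<forall>m\<ge>1. hypercyclic_on (power_space m) (direct_sum_op m (\<lambda>l. T ^^ l))) \<longleftrightarrow> weight_condition"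
  using hypercyclic_direct_sum_if_densely_d_hypercyclic densely_d_hypercyclic_if_weight_condition
    weight_condition_if_hypercyclic by blast

lemma densely_d_hypercyclic_iff_weight_condition:
  "(\<forall>m\<ge>1. densely_d_hypercyclic m (\<lambda>l. T ^^ l)) \<longleftrightarrow> weight_condition"
  using hypercyclic_direct_sum_if_densely_d_hypercyclic densely_d_hypercyclic_if_weight_condition
    weight_condition_if_hypercyclic by blast

lemma divergence_condition_iff_weight_condition:
  "invertible_operator T \<Longrightarrow> divergence_condition \<longleftrightarrow> weight_condition"
  using weight_condition_imp_divergence_condition divergence_condition_imp_weight_condition by blast

end

theorem proposition5p3:
  fixes w :: "int \<Rightarrow> real" and T :: "ell2_int \<Rightarrow> ell2_int"
  assumes "bilateral_weighted_shift w T"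
  shows
    "(topologically_multiply_recurrent T \<longleftrightarrow>
       (\<forall>m\<ge>1. hypercyclic_on (power_space m) (direct_sum_op m (\<lambda>l. T ^^ l)))) \<and>
     (topologically_multiply_recurrent T \<longleftrightarrow>
       (\<forall>m\<ge>1. densely_d_hypercyclic m (\<lambda>l. T ^^ l))) \<and>
     (topologically_multiply_recurrent T \<longleftrightarrow>
       (\<forall>m\<ge>1. \<forall>q\<ge>1. \<forall>\<epsilon>>0. \<exists>n\<ge>1. \<forall>j::int. \<bar>j\<bar> \<le> int q \<longrightarrow>
          (\<forall>l\<in>{1..m}. (\<Prod>i=1..l * n. w (j + int i)) > 1 / \<epsilon> \<and>
                       (\<Prod>i=0..l * n - 1. w (j - int i)) < \<epsilon>))) \<and>
     (invertible_operator T \<longrightarrow>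
       (topologically_multiply_recurrent T \<longleftrightarrow>
         (\<forall>m\<ge>1. \<exists>nk :: nat \<Rightarrow> nat. strict_mono nk \<and> (\<forall>k. nk k \<ge> 1) \<and>
           (\<forall>l\<in>{1..m}.
              filterlim (\<lambda>k. \<Prod>i=1..l * nk k. w (int i)) at_top sequentially \<and>
              filterlim (\<lambda>k. \<Prod>i=0..l * nk k. 1 / w (- int i)) at_top sequentially))))"
proof -
  interpret weighted_shift w T
    using assms by unfold_locales
  show ?thesis
    unfolding multiply_recurrent_iff_weight_condition hypercyclic_iff_weight_condition
      densely_d_hypercyclic_iff_weight_condition weight_condition_iff[symmetric]
      divergence_condition_iff[symmetric]
    using divergence_condition_iff_weight_condition by blast
qed

end
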